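(* Every bounded statistically convergent real sequence is GAS convergent with the same limit; that is, if $x\in st$ and $\mathrm{stat}\lim_{n\to\infty}x_n=\ell$, then $x$ is GAS convergent to $\ell$. In particular $st\subset\mathcal S$.
   Context: $l_\infty$ is the normed linear space of all bounded real sequences $x=(x_n)_{n\in\mathbb N}$, $\mathbb N=\{1,2,3,\dots\}$, with the norm $\|x\|_\infty=\sup_n|x_n|$. For $P\subset\mathbb N$, the natural density is $\delta(P)=\lim_{n\to\infty}\frac{|P\cap\{1,\dots,n\}|}{n}$ when the limit exists. A condition holds for "a.a.$k$" (almost all $k$) if the set $E$ of $k\in\mathbb N$ for which it fails has $\delta(E)=0$. A real sequence $(p_k)$ converges statistically to $\ell\in\mathbb R$, written $\mathrm{stat}\lim_{n\to\infty} p_n=\ell$, if for every $\epsilon>0$, $\delta(\{k\in\mathbb N:|p_k-\ell|>\epsilon\})=0$. $st\subset l_\infty$ is the subspace of all bounded statistically convergent real sequences, and $g:st\to\mathbb R$, $g(x)=\mathrm{stat}\lim_{n\to\infty}x_n$, is the statistical limit functional. $S$ is the shift operator $S((x_n)_{n=1}^\infty)=(x_n)_{n=2}^\infty$. A linear functional $\mathcal F:l_\infty\to\mathbb R$ is a Banach statistical limit functional if: (i) $\|\mathcal F\|=1$; (ii) $\mathcal F|_{st}=g$; (iii) if $s\in l_\infty$ with $s_n\ge0$ a.a.$n$, then $\mathcal F(s)\ge0$; (iv) for every $x\in l_\infty$, $\mathcal F(x)=\mathcal F(Tx)$ for every map $T:l_\infty\to l_\infty$ such that $(Ty)_k=(Sy)_k$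 a.a.$k$ for each $y\in l_\infty$. A sequence $x\in l_\infty$ is generalized almost statistically (GAS) convergent to $\lambda$ if $\mathcal F(x)=\lambda$ for all Banach statistical limit functionals $\mathcal F$. $\mathcal S$ is the set of all GAS convergent real sequences. *)

theory Defs
  imports "HOL-Analysis.Analysis"
begin

text \<open>
  Sequences are indexed from \<open>0\<close>: the term at index \<open>n\<close> is the mathematical \<open>x\<^sub>n\<^sub>+\<^sub>1\<close>. Accordingly
  densities count over the \<open>n\<close> indices \<open>{..<n}\<close>, which stand for \<open>{1,\<dots>,n}\<close>.

  Since \<open>nat\<close> carries the discrete topology, every function on it is continuous, so the bounded
  continuous functions on \<open>nat\<close>, with their supremum norm, are exactly the space \<open>l\<^sub>\<infinity>\<close>.
\<close>

type_synonym linf = "nat \<Rightarrow>\<^sub>C real"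

definition has_natural_density :: "nat set \<Rightarrow> real \<Rightarrow> bool" where
  "has_natural_density P d \<longleftrightarrow>
     (\<lambda>n. real (card (P \<inter> {..<n})) / real n) \<longlonglongrightarrow> d"

definition almost_all :: "(nat \<Rightarrow> bool) \<Rightarrow> bool" where
  "almost_all Q \<longleftrightarrow> has_natural_density {k. \<not> Q k} 0"

definition stat_tendsto :: "(nat \<Rightarrow> real) \<Rightarrow> real \<Rightarrow> bool" where
  "stat_tendsto p l \<longleftrightarrow> (\<forall>\<epsilon>>0. has_natural_density {k. \<bar>p k - l\<bar> > \<epsilon>} 0)"

definition stat_lim :: "(nat \<Rightarrow> real) \<Rightarrow> real" where
  "stat_lim p = (THE l. stat_tendsto p l)"

definition st :: "linf set" where
  "st = {x. \<exists>l. stat_tendsto (apply_bcontfun x) l}"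

definition shift :: "linf \<Rightarrow> linf" where
  "shift x = Bcontfun (\<lambda>n. apply_bcontfun x (Suc n))"

lemma apply_shift: "apply_bcontfun (shift x) n = apply_bcontfun x (Suc n)"
proof -
  have "range (\<lambda>n. apply_bcontfun x (Suc n)) \<subseteq> range (apply_bcontfun x)"
    by auto
  then have "bounded (range (\<lambda>n. apply_bcontfun x (Suc n)))"
    by (rule bounded_subset[OF bounded_apply_bcontfun])
  then have "(\<lambda>n. apply_bcontfun x (Suc n)) \<in> bcontfun"
    by (simp add: bcontfun_def)
  then show ?thesis
    by (simp add: shift_def Bcontfun_inverse)
qed

text \<open>
  A linear functional of norm \<open>1\<close> is bounded, so functionals are taken from the dual space of
  \<open>l\<^sub>\<infinity>\<close>, whose norm is the operator norm. In the last clause \<open>T\<close> ranges over arbitrary maps,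
  with no linearity or continuity required.
\<close>

definition Banach_stat_limit_functional :: "(linf \<Rightarrow>\<^sub>L real) \<Rightarrow> bool" where
  "Banach_stat_limit_functional F \<longleftrightarrow>
     norm F = 1 \<and>
     (\<forall>x\<in>st. blinfun_apply F x = stat_lim (apply_bcontfun x)) \<and>
     (\<forall>s. almost_all (\<lambda>n. apply_bcontfun s n \<ge> 0) \<longrightarrow> blinfun_apply F s \<ge> 0) \<and>
     (\<forall>x. \<forall>T :: linf \<Rightarrow> linf.
        (\<forall>y. almost_all (\<lambda>k. apply_bcontfun (T y) k = apply_bcontfun (shift y) k)) \<longrightarrow>
        blinfun_apply F x = blinfun_apply F (T x))"

definition GAS_convergent_to :: "linf \<Rightarrow> real \<Rightarrow> bool" where
  "GAS_convergent_to x c \<longleftrightarrow>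
     (\<forall>F. Banach_stat_limit_functional F \<longrightarrow> blinfun_apply F x = c)"

definition GAS :: "linf set" where
  "GAS = {x. \<exists>c. GAS_convergent_to x c}"

end

theory Submission
  imports Defs
begin

text \<open>
  A Banach statistical limit functional extends the statistical limit functional, so on a bounded
  statistically convergent sequence every such functional takes the one value \<open>stat_lim x\<close>.
  What remains is that \<open>stat_lim\<close>, a definite description, denotes the given limit, that is, that
  statistical limits are unique. If \<open>l\<close> and \<open>m\<close> were two different limits, then each term of the
  sequence would be far from \<open>l\<close> or far from \<open>m\<close>, so two sets of density zero would cover \<open>\<nat>\<close>,
  whose density is one.
\<close>

text \<open>
  The counting ratios of \<open>A\<close> and \<open>B\<close> add up to at least \<open>1\<close> at every \<open>n > 0\<close>, which
  survives in the limit.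
\<close>

lemma natural_densities_of_cover_sum_ge_1:
  assumes A: "has_natural_density A a" and B: "has_natural_density B b"
    and cover: "A \<union> B = UNIV"
  shows "1 \<le> a + b"
proof (rule tendsto_lowerbound)
  show "(\<lambda>n. real (card (A \<inter> {..<n})) / real n + real (card (B \<inter> {..<n})) / real n)
          \<longlonglongrightarrow> a + b"
    using A B unfolding has_natural_density_def by (rule tendsto_add)
  show "\<forall>\<^sub>F n in sequentially.
          1 \<le> real (card (A \<inter> {..<n})) / real n + real (card (B \<inter> {..<n})) / real n"
    using eventually_gt_at_top[of 0]
  proof eventually_elim
    case (elim n)
    have "(A \<inter> {..<n}) \<union> (B \<inter> {..<n}) = {..<n}"
      using cover by blast
    then have "n \<le> card (A \<inter> {..<n}) + card (B \<inter> {..<n})"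
      using card_Un_le[of "A \<inter> {..<n}" "B \<inter> {..<n}"] by simp
    then have "real n \<le> real (card (A \<inter> {..<n})) + real (card (B \<inter> {..<n}))"
      by linarith
    then show ?case
      using elim by (simp add: add_divide_distrib[symmetric])
  qed
qed simp

lemma stat_tendsto_unique:
  assumes l: "stat_tendsto p l" and m: "stat_tendsto p m"
  shows "l = m"
proof (rule ccontr)
  assume "l \<noteq> m"
  \<comment> \<open>At this radius the closed neighbourhoods of \<open>l\<close> and \<open>m\<close> are disjoint.\<close>
  define \<epsilon> where "\<epsilon> = \<bar>l - m\<bar> / 3"
  have pos: "\<epsilon> > 0"
    using \<open>l \<noteq> m\<close> by (simp add: \<epsilon>_def)
  have "\<bar>p k - l\<bar> > \<epsilon> \<or> \<bar>p k - m\<bar> > \<epsilon>" for k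
  proof -
    have "\<bar>l - m\<bar> \<le> \<bar>p k - l\<bar> + \<bar>p k - m\<bar>"
      by linarith
    then show ?thesis
      using pos unfolding \<epsilon>_def by argo
  qed
  then have "{k. \<bar>p k - l\<bar> > \<epsilon>} \<union> {k. \<bar>p k - m\<bar> > \<epsilon>} = UNIV"
    by blast
  moreover have "has_natural_density {k. \<bar>p k - l\<bar> > \<epsilon>} 0"
    and "has_natural_density {k. \<bar>p k - m\<bar> > \<epsilon>} 0"
    using l m pos by (simp_all add: stat_tendsto_def)
  ultimately have "(1 :: real) \<le> 0 + 0"
    by (intro natural_densities_of_cover_sum_ge_1)
  then show False
    by simp
qed

lemma stat_lim_eqI:
  assumes "stat_tendsto p l"
  shows "stat_lim p = l"
  unfolding stat_lim_def using assms by (blast intro: stat_tendsto_unique)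

lemma stat_tendsto_imp_GAS_convergent_to:
  assumes "stat_tendsto (apply_bcontfun x) l"
  shows "GAS_convergent_to x l"
proof -
  have "x \<in> st"
    using assms by (auto simp: st_def)
  then show ?thesis
    using stat_lim_eqI[OF assms]
    by (simp add: GAS_convergent_to_def Banach_stat_limit_functional_def)
qed

theorem corollary3p2p3:
  shows "(\<forall>(x :: linf) (l :: real).
            x \<in> st \<and> stat_tendsto (apply_bcontfun x) l \<longrightarrow> GAS_convergent_to x l) \<and>
         st \<subseteq> GAS"
  using stat_tendsto_imp_GAS_convergent_to by (auto simp: st_def GAS_def)

end
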